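(* Let $\alpha_1,\alpha_2,\alpha_3\in\mathbb{F}_{p^m}^*$ and $\alpha_4\in\mathbb{F}_{p^m}$ be such that $\alpha=\alpha_1+\alpha_2u+\alpha_3v+\alpha_4uv$ is not a cube in $\mathcal{R}$. Let $0\le\ell\le2p^s-1$ and let $\mathcal{C}=\langle u(x^3-\alpha_0)^\ell\rangle\subseteq\frac{\mathcal{R}[x]}{\langle x^{3p^s}-\alpha\rangle}$ be the corresponding $\alpha$-constacyclic code of length $3p^s$ over $\mathcal{R}$. Then $\mathcal{C}^\perp=\langle(x^3-\alpha_0^{-1})^{2p^s-\ell},\,u\rangle$, as an ideal of $\frac{\mathcal{R}[x]}{\langle x^{3p^s}-\alpha^{-1}\rangle}$.
   Context: $p\neq3$ is a prime, $m,s$ are positive integers, and $\mathcal{R}=\frac{\mathbb{F}_{p^m}[u,v]}{\langle u^2,v^2,uv-vu\rangle}=\mathbb{F}_{p^m}+u\mathbb{F}_{p^m}+v\mathbb{F}_{p^m}+uv\mathbb{F}_{p^m}$ with $u^2=v^2=0$, $uv=vu$. Writing $s=q_0m+r_0$ with $q_0\ge0$ and $0\le r_0\le m-1$, put $\alpha_0=\alpha_1^{p^{m-r_0}}$, so that $\alpha_0^{p^s}=\alpha_1$. A vector $(c_0,\dots,c_{n-1})\in\mathcal{R}^n$, $n=3p^s$, is identified with $c_0+c_1x+\dots+c_{n-1}x^{n-1}$; under this identification $\alpha$-constacyclic codes of length $3p^s$ are the ideals of $\frac{\mathcal{R}[x]}{\langle x^{3p^s}-\alpha\rangle}$. $\mathcal{C}^\perp$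 is the dual of $\mathcal{C}$ with respect to the standard inner product on $\mathcal{R}^n$; it is an $\alpha^{-1}$-constacyclic code, i.e. an ideal of $\frac{\mathcal{R}[x]}{\langle x^{3p^s}-\alpha^{-1}\rangle}$. *)

theory Defs
  imports
    "HOL-Algebra.Algebraic_Closure_Type"
    "HOL-Computational_Algebra.Polynomial"
    "HOL-Computational_Algebra.Primes"
    "Jordan_Normal_Form.Matrix"
begin

section \<open>The ring F[u,v] / (u^2, v^2)\<close>

text \<open>F[u,v] is taken to be (F[u])[v], the type \<open>'a poly poly\<close>; it is commutative, so the
  generator uv - vu of the ideal is 0.\<close>

definition poly_u :: "'a::comm_ring_1 poly poly" where
  "poly_u = [:[:0, 1:]:]"

definition poly_v :: "'a::comm_ring_1 poly poly" where
  "poly_v = [:0, 1:]"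

definition uv_rel :: "'a::comm_ring_1 poly poly \<Rightarrow> 'a poly poly \<Rightarrow> bool" where
  "uv_rel f g \<longleftrightarrow> (\<exists>a b. f - g = a * poly_u^2 + b * poly_v^2)"

lemma uv_rel_refl: "uv_rel f f"
  unfolding uv_rel_def by (rule exI[of _ 0], rule exI[of _ 0]) simp

lemma uv_rel_minus: "uv_rel f g \<Longrightarrow> uv_rel (- f) (- g)"
proof -
  assume "uv_rel f g"
  then obtain a b where "f - g = a * poly_u^2 + b * poly_v^2" unfolding uv_rel_def by blast
  hence "- f - - g = (-a) * poly_u^2 + (-b) * poly_v^2" by (simp add: algebra_simps)
  thus ?thesis unfolding uv_rel_def by blast
qed

lemma uv_rel_sym: "uv_rel f g \<Longrightarrow> uv_rel g f"
proof -
  assume "uv_rel f g"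
  then obtain a b where "f - g = a * poly_u^2 + b * poly_v^2" unfolding uv_rel_def by blast
  hence "g - f = (-a) * poly_u^2 + (-b) * poly_v^2" by (simp add: algebra_simps)
  thus ?thesis unfolding uv_rel_def by blast
qed

lemma uv_rel_add:
  assumes "uv_rel f g" "uv_rel f' g'"
  shows "uv_rel (f + f') (g + g')"
proof -
  obtain a b where 1: "f - g = a * poly_u^2 + b * poly_v^2"
    using assms(1) unfolding uv_rel_def by blast
  obtain a' b' where 2: "f' - g' = a' * poly_u^2 + b' * poly_v^2"
    using assms(2) unfolding uv_rel_def by blast
  have "f + f' - (g + g') = (f - g) + (f' - g')" by simp
  also have "\<dots> = (a + a') * poly_u^2 + (b + b') * poly_v^2"
    unfolding 1 2 by (simp add: algebra_simps)
  finally show ?thesis unfolding uv_rel_def by blast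
qed

lemma uv_rel_trans: "uv_rel f g \<Longrightarrow> uv_rel g h \<Longrightarrow> uv_rel f h"
  using uv_rel_add[of f g "g - g" "h - g"] uv_rel_add[of g h "- g" "- g"] uv_rel_refl[of "- g"]
  by simp

lemma uv_rel_mult:
  assumes "uv_rel f g" "uv_rel f' g'"
  shows "uv_rel (f * f') (g * g')"
proof -
  obtain a b where 1: "f - g = a * poly_u^2 + b * poly_v^2"
    using assms(1) unfolding uv_rel_def by blast
  obtain a' b' where 2: "f' - g' = a' * poly_u^2 + b' * poly_v^2"
    using assms(2) unfolding uv_rel_def by blast
  have "f * f' - g * g' = (f - g) * f' + g * (f' - g')" by (simp add: algebra_simps)
  also have "\<dots> = (a * f' + g * a') * poly_u^2 + (b * f' + g * b') * poly_v^2"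
    unfolding 1 2 by (simp add: algebra_simps)
  finally show ?thesis unfolding uv_rel_def by blast
qed

lemma equivp_uv_rel: "equivp uv_rel"
  using uv_rel_refl uv_rel_sym uv_rel_trans
  by (intro equivpI reflpI sympI transpI) blast+

lemma poly_u2: "poly_u^2 = [:[:0, 0, 1:]:]"
  by (simp add: poly_u_def power2_eq_square)

lemma poly_v2: "poly_v^2 = [:0, 0, 1:]"
  by (simp add: poly_v_def power2_eq_square)

lemma coeff_uv_ideal:
  assumes "f - g = a * poly_u^2 + b * poly_v^2" "i < 2" "j < 2"
  shows "Polynomial.coeff (Polynomial.coeff f i) j = Polynomial.coeff (Polynomial.coeff g i) j"
proof -
  have j: "j = 0 \<or> j = 1" and i: "i = 0 \<or> i = 1" using assms by auto
  have "Polynomial.coeff (Polynomial.coeff (f - g) i) j = 0"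
    unfolding assms(1) poly_u2 poly_v2 using i j by (auto simp: coeff_pCons split: nat.splits)
  thus ?thesis by simp
qed

quotient_type (overloaded) 'a uv_ring = "'a::comm_ring_1 poly poly" / uv_rel
  by (rule equivp_uv_rel)

instantiation uv_ring :: (comm_ring_1) comm_ring_1
begin

lift_definition zero_uv_ring :: "'a uv_ring" is 0 .
lift_definition one_uv_ring :: "'a uv_ring" is 1 .
lift_definition plus_uv_ring :: "'a uv_ring \<Rightarrow> 'a uv_ring \<Rightarrow> 'a uv_ring" is "(+)"
  by (rule uv_rel_add)
lift_definition uminus_uv_ring :: "'a uv_ring \<Rightarrow> 'a uv_ring" is uminus
  by (rule uv_rel_minus)
lift_definition minus_uv_ring :: "'a uv_ring \<Rightarrow> 'a uv_ring \<Rightarrow> 'a uv_ring" is "(-)"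
  using uv_rel_add uv_rel_minus by fastforce
lift_definition times_uv_ring :: "'a uv_ring \<Rightarrow> 'a uv_ring \<Rightarrow> 'a uv_ring" is "(*)"
  by (rule uv_rel_mult)

instance
proof
  show "(0::'a uv_ring) \<noteq> 1"
  proof (transfer, rule notI)
    assume "uv_rel (0::'a poly poly) 1"
    then obtain a b :: "'a poly poly" where "0 - 1 = a * poly_u^2 + b * poly_v^2"
      unfolding uv_rel_def by blast
    from coeff_uv_ideal[OF this, of 0 0] show False by simp
  qed
qed (transfer; simp add: algebra_simps uv_rel_refl)+

end

lift_definition embed :: "'a::comm_ring_1 \<Rightarrow> 'a uv_ring" is "\<lambda>c. [:[:c:]:]" .
lift_definition uu :: "'a::comm_ring_1 uv_ring" is poly_u .
lift_definition vv :: "'a::comm_ring_1 uv_ring" is poly_v .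

lemma uv_ring_normal_form:
  fixes x :: "'a::comm_ring_1 uv_ring"
  shows "\<exists>!(a, b, c, d). x = embed a + embed b * uu + embed c * vv + embed d * uu * vv"
proof -
  let ?E = "\<lambda>a b c d. [:[:a:]:] + [:[:b:]:] * poly_u + [:[:c:]:] * poly_v
      + [:[:d:]:] * poly_u * poly_v :: 'a poly poly"
  have ex: "\<exists>a b c d. x = embed a + embed b * uu + embed c * vv + embed d * uu * vv"
  proof (transfer)
    fix f :: "'a poly poly"
    obtain g0 f1 where f1: "f = pCons g0 f1" by (cases f)
    obtain g1 f2 where f2: "f1 = pCons g1 f2" by (cases f1)
    obtain a h where g0: "g0 = pCons a h" by (cases g0)
    obtain b h' where h: "h = pCons b h'" by (cases h)
    obtain c k where g1: "g1 = pCons c k" by (cases g1)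
    obtain d k' where k: "k = pCons d k'" by (cases k)
    have "f - ?E a b c d = [:h', k':] * poly_u^2 + f2 * poly_v^2"
      unfolding poly_u2 poly_v2 unfolding f1 f2 g0 h g1 k poly_u_def poly_v_def
      by simp
    thus "\<exists>a b c d. uv_rel f (?E a b c d)" unfolding uv_rel_def by blast
  qed
  have un: "a = a' \<and> b = b' \<and> c = c' \<and> d = d'"
    if "embed a + embed b * uu + embed c * vv + embed d * uu * vv
      = embed a' + embed b' * uu + embed c' * vv + embed d' * uu * vv" for a b c d a' b' c' d' :: 'a
    using that
  proof (transfer)
    fix a b c d a' b' c' d' :: 'a
    assume "uv_rel (?E a b c d) (?E a' b' c' d')"
    then obtain p q where *: "?E a b c d - ?E a' b' c' d' = p * poly_u^2 + q * poly_v^2"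
      unfolding uv_rel_def by blast
    show "a = a' \<and> b = b' \<and> c = c' \<and> d = d'"
      using coeff_uv_ideal[OF *, of 0 0] coeff_uv_ideal[OF *, of 0 1]
        coeff_uv_ideal[OF *, of 1 0] coeff_uv_ideal[OF *, of 1 1]
      by (simp add: poly_u_def poly_v_def)
  qed
  show ?thesis using ex un by (auto simp: Ex1_def) blast+
qed

lemma uu_vv_relations: "(uu :: 'a::comm_ring_1 uv_ring)^2 = 0" "(vv :: 'a uv_ring)^2 = 0"
proof -
  have "uv_rel (poly_u * poly_u) (0 :: 'a poly poly)"
    unfolding uv_rel_def by (rule exI[of _ 1], rule exI[of _ 0]) (simp add: power2_eq_square)
  hence "uu * uu = (0 :: 'a uv_ring)" by transfer
  thus "(uu :: 'a uv_ring)^2 = 0" by (simp add: power2_eq_square)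
  have "uv_rel (poly_v * poly_v) (0 :: 'a poly poly)"
    unfolding uv_rel_def by (rule exI[of _ 0], rule exI[of _ 1]) (simp add: power2_eq_square)
  hence "vv * vv = (0 :: 'a uv_ring)" by transfer
  thus "(vv :: 'a uv_ring)^2 = 0" by (simp add: power2_eq_square)
qed

section \<open>Constacyclic codes\<close>

definition modulus_ideal :: "nat \<Rightarrow> 'r::comm_ring_1 \<Rightarrow> 'r poly set" where
  "modulus_ideal n a =
     PIdl\<^bsub>ring_of_type_algebra\<^esub> (Polynomial.monom 1 n - [:a:])"

text \<open>The ring R[x] / (x^n - a); its elements are cosets.\<close>

definition constacyclic_ring :: "nat \<Rightarrow> 'r::comm_ring_1 \<Rightarrow> 'r poly set ring" where
  "constacyclic_ring n a = ring_of_type_algebra Quot modulus_ideal n a"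

definition residue_class :: "nat \<Rightarrow> 'r::comm_ring_1 \<Rightarrow> 'r poly \<Rightarrow> 'r poly set" where
  "residue_class n a f = modulus_ideal n a +>\<^bsub>ring_of_type_algebra\<^esub> f"

text \<open>The ideal of R[x] / (x^n - a) generated by the classes of the polynomials in S.\<close>

definition code_generated ::
    "nat \<Rightarrow> 'r::comm_ring_1 \<Rightarrow> 'r poly set \<Rightarrow> 'r poly set set" where
  "code_generated n a S = Idl\<^bsub>constacyclic_ring n a\<^esub> (residue_class n a ` S)"

text \<open>The identification of (c_0, ..., c_{n-1}) with c_0 + c_1 x + ... + c_{n-1} x^{n-1}.\<close>

definition vec_poly :: "'r::comm_ring_1 vec \<Rightarrow> 'r poly" where
  "vec_poly c = (\<Sum>i<dim_vec c. Polynomial.monom (c $ i) i)"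

definition vec_class :: "nat \<Rightarrow> 'r::comm_ring_1 \<Rightarrow> 'r vec \<Rightarrow> 'r poly set" where
  "vec_class n a c = residue_class n a (vec_poly c)"

definition codewords :: "nat \<Rightarrow> 'r::comm_ring_1 \<Rightarrow> 'r poly set set \<Rightarrow> 'r vec set" where
  "codewords n a C = {c \<in> carrier_vec n. vec_class n a c \<in> C}"

definition dual_code :: "nat \<Rightarrow> 'r::comm_ring_1 vec set \<Rightarrow> 'r vec set" where
  "dual_code n K = {d \<in> carrier_vec n. \<forall>c\<in>K. c \<bullet> d = 0}"

lemma modulus_ideal_eq:
  "modulus_ideal n a = {g * (Polynomial.monom 1 n - [:a:]) | g. True}"
  unfolding modulus_ideal_def cgenideal_def by (simp add: ring_of_type_algebra_def)

lemma residue_class_eq: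
  "residue_class n a f = {g * (Polynomial.monom 1 n - [:a:]) + f | g. True}"
  unfolding residue_class_def modulus_ideal_eq a_r_coset_def' 
  by (auto simp: ring_of_type_algebra_def)

lemma residue_class_eq_iff:
  "residue_class n a f = residue_class n a g \<longleftrightarrow> (Polynomial.monom 1 n - [:a:]) dvd f - g"
proof
  assume *: "residue_class n a f = residue_class n a g"
  have "f \<in> residue_class n a f" unfolding residue_class_eq by (auto intro: exI[of _ 0])
  hence "f \<in> residue_class n a g" by (simp only: *)
  then obtain h where "f = h * (Polynomial.monom 1 n - [:a:]) + g"
    unfolding residue_class_eq by blast
  thus "(Polynomial.monom 1 n - [:a:]) dvd f - g" by simp
next
  assume "(Polynomial.monom 1 n - [:a:]) dvd f - g"
  then obtain h where h: "f - g = (Polynomial.monom 1 n - [:a:]) * h" by (rule dvdE)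
  have f: "f = h * (Polynomial.monom 1 n - [:a:]) + g" using h by (simp add: algebra_simps)
  have "\<exists>k'. k * (Polynomial.monom 1 n - [:a:]) + f = k' * (Polynomial.monom 1 n - [:a:]) + g" for k
    unfolding f by (rule exI[of _ "k + h"]) (simp add: algebra_simps smult_add_right smult_diff_right)
  moreover have "\<exists>k'. k * (Polynomial.monom 1 n - [:a:]) + g = k' * (Polynomial.monom 1 n - [:a:]) + f" for k
    unfolding f by (rule exI[of _ "k - h"]) (simp add: algebra_simps smult_add_right smult_diff_right)
  ultimately show "residue_class n a f = residue_class n a g"
    unfolding residue_class_eq by auto
qed

lemma carrier_constacyclic_ring:
  "carrier (constacyclic_ring n a) = range (residue_class n a)"
  unfolding constacyclic_ring_def FactRing_def A_RCOSETS_def' residue_class_def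
  by (auto simp: ring_of_type_algebra_def)

lemma coeff_vec_poly: "Polynomial.coeff (vec_poly c) i = (if i < dim_vec c then c $ i else 0)"
  unfolding vec_poly_def by (simp add: coeff_sum)

lemma bij_betw_vec_class:
  fixes a :: "'r::comm_ring_1"
  assumes "n > 0"
  shows "bij_betw (vec_class n a) (carrier_vec n) (carrier (constacyclic_ring n a))"
proof -
  let ?m = "Polynomial.monom 1 n - [:a:] :: 'r poly"
  have cm: "Polynomial.coeff ?m n = 1" using assms by (cases n) (auto)
  have "Polynomial.degree ?m \<le> n"
    using degree_diff_le[OF degree_monom_le[of "1::'r" n], of "[:a:]"] by simp
  with cm have dm: "Polynomial.degree ?m = n"
    by (metis le_antisym le_degree zero_neq_one)
  have m0: "?m \<noteq> 0" using cm by (metis coeff_0 zero_neq_one)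
  have deg_ge: "Polynomial.degree (?m * h) \<ge> n" if "h \<noteq> 0" for h
  proof -
    have "Polynomial.coeff (?m * h) (n + Polynomial.degree h) = lead_coeff h"
      using coeff_mult_degree_sum[of ?m h] cm dm by simp
    thus ?thesis using that le_degree[of "?m * h" "n + Polynomial.degree h"]
      by (simp del: mult_minus_left)
  qed
  show ?thesis unfolding bij_betw_def
  proof
    show "inj_on (vec_class n a) (carrier_vec n)"
    proof (rule inj_onI)
      fix c d assume c: "c \<in> carrier_vec n" and d: "d \<in> carrier_vec n"
        and "vec_class n a c = vec_class n a d"
      hence "?m dvd vec_poly c - vec_poly d"
        unfolding vec_class_def residue_class_eq_iff by simp
      then obtain h where h: "vec_poly c - vec_poly d = ?m * h" by (rule dvdE)
      have "Polynomial.degree (vec_poly c - vec_poly d) < n"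
        by (rule degree_lessI) (use assms c d in \<open>auto simp: coeff_vec_poly\<close>)
      hence "h = 0" using deg_ge[of h] h by fastforce
      hence eq: "vec_poly c = vec_poly d" using h by simp
      show "c = d"
      proof (rule eq_vecI)
        show "dim_vec c = dim_vec d" using c d by simp
        fix i assume "i < dim_vec d"
        thus "c $ i = d $ i" using arg_cong[OF eq, of "\<lambda>f. Polynomial.coeff f i"] c d
          by (simp add: coeff_vec_poly)
      qed
    qed
    have "\<exists>c\<in>carrier_vec n. residue_class n a f = vec_class n a c" for f
    proof -
      obtain q r where qr: "pseudo_divmod f ?m = (q, r)" by force
      have f: "f = ?m * q + r" and r: "r = 0 \<or> Polynomial.degree r < n"
        using pseudo_divmod[OF m0 qr] cm dm by auto
      let ?c = "vec n (Polynomial.coeff r)"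
      have "vec_poly ?c = r"
        using r by (auto intro!: poly_eqI simp: coeff_vec_poly coeff_eq_0)
      hence "residue_class n a f = vec_class n a ?c"
        unfolding vec_class_def residue_class_eq_iff using f by simp
      thus ?thesis by (intro bexI[of _ ?c]) auto
    qed
    thus "vec_class n a ` carrier_vec n = carrier (constacyclic_ring n a)"
      unfolding carrier_constacyclic_ring by (auto simp: vec_class_def)
  qed
qed

end

theory Submission
  imports Defs "HOL-Number_Theory.Residues"
begin

text \<open>
  Write \<open>q = p ^ s\<close>, \<open>n = 3 q\<close>, \<open>P = x ^ 3 - \<alpha>0\<close>, \<open>Q = x ^ 3 - 1 / \<alpha>0\<close> and
  \<open>w = \<alpha> - \<alpha>1\<close>, a nilpotent constant. The Frobenius map gives \<open>P ^ q = x ^ n - \<alpha>1\<close>, so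
  \<open>P ^ q = w\<close> in \<open>R[x] / (x ^ n - \<alpha>)\<close>.

  The dual of an ideal is its annihilator, read backwards. In \<open>R[x] / (x ^ n - \<alpha>)\<close> the element
  \<open>\<beta> x ^ (n - 1)\<close>, with \<open>\<beta> = 1 / \<alpha>\<close>, is the inverse of \<open>x\<close>, and the standard inner product
  of \<open>c\<close> and \<open>d\<close> is the constant coefficient of the remainder of \<open>c(x) d(1 / x)\<close>. Since a code
  generated by \<open>g\<close> contains all multiples of \<open>g\<close>, all coefficients of \<open>g(x) d(1 / x)\<close> vanish as
  soon as \<open>d\<close> is orthogonal to the code; hence \<open>d\<close> lies in the dual iff
  \<open>g(x) d(1 / x) = 0\<close> (\<open>dual_code_iff_annihilates\<close>).

  For \<open>g = u P ^ l\<close> the annihilator is generated by \<open>P ^ (2 q - l)\<close> and \<open>u\<close>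
  (\<open>uv_annihilator\<close>). The reason is that \<open>u R\<close> is \<open>R / u R\<close> as a module, and modulo \<open>u\<close> the
  relation \<open>P ^ q = \<alpha>3 v\<close> eliminates \<open>v\<close>, as \<open>\<alpha>3\<close> is invertible, and turns \<open>v ^ 2 = 0\<close> into
  \<open>P ^ (2 q) = 0\<close>. The annihilator of \<open>P ^ l\<close> in \<open>F[x] / (P ^ (2 q))\<close> is generated by
  \<open>P ^ (2 q - l)\<close>.

  The map \<open>f(x) \<mapsto> f(1 / x)\<close> identifies \<open>R[x] / (x ^ n - \<beta>)\<close> with \<open>R[x] / (x ^ n - \<alpha>)\<close> and
  takes \<open>Q\<close> to a unit times \<open>P\<close>, because
  \<open>x ^ (-3) - 1 / \<alpha>0 = - (1 / \<alpha>0) x ^ (-3) (x ^ 3 - \<alpha>0)\<close>. So the condition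
  that \<open>d(1 / x)\<close> lies in the ideal generated by \<open>P ^ (2 q - l)\<close> and \<open>u\<close> says that \<open>d\<close> lies in
  the ideal generated by \<open>Q ^ (2 q - l)\<close> and \<open>u\<close> (\<open>subst_recip_gen_ideal_iff\<close>).
\<close>


section \<open>Ideals of R[x] / (x^n - a)\<close>

abbreviation xpow_minus :: "nat \<Rightarrow> 'r::comm_ring_1 \<Rightarrow> 'r poly" where
  "xpow_minus n a \<equiv> Polynomial.monom 1 n - [:a:]"

text \<open>Three generators are what is needed to describe an ideal of \<open>R[x] / (x ^ n - a)\<close> with two
  generators by its preimage in \<open>R[x]\<close>: the third one is the modulus.\<close>

definition gen_ideal :: "'r::comm_ring_1 \<Rightarrow> 'r \<Rightarrow> 'r \<Rightarrow> 'r set" where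
  "gen_ideal f g h = {x * f + y * g + z * h | x y z. True}"

lemma gen_idealI: "w = x * f + y * g + z * h \<Longrightarrow> w \<in> gen_ideal f g h"
  unfolding gen_ideal_def by blast

lemma gen_ideal_add:
  assumes "v \<in> gen_ideal f g h" "w \<in> gen_ideal f g h"
  shows "v + w \<in> gen_ideal f g h"
proof -
  obtain x y z where 1: "v = x * f + y * g + z * h" using assms(1) unfolding gen_ideal_def by blast
  obtain x' y' z' where 2: "w = x' * f + y' * g + z' * h" using assms(2) unfolding gen_ideal_def by blast
  show ?thesis unfolding 1 2
    by (rule gen_idealI[of _ "x + x'" _ "y + y'" _ "z + z'"]) (simp add: algebra_simps)
qed

lemma gen_ideal_mult:
  assumes "w \<in> gen_ideal f g h"
  shows "c * w \<in> gen_ideal f g h"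
proof -
  obtain x y z where 1: "w = x * f + y * g + z * h" using assms unfolding gen_ideal_def by blast
  show ?thesis unfolding 1
    by (rule gen_idealI[of _ "c * x" _ "c * y" _ "c * z"]) (simp add: algebra_simps)
qed

lemma gen_ideal_gens: "f \<in> gen_ideal f g h" "g \<in> gen_ideal f g h" "h \<in> gen_ideal f g h"
  by (rule gen_idealI[of _ 1 _ 0 _ 0]; simp) (rule gen_idealI[of _ 0 _ 1 _ 0], simp,
      rule gen_idealI[of _ 0 _ 0 _ 1], simp)

lemma gen_ideal_cong:
  assumes "h dvd v - w"
  shows "v \<in> gen_ideal f g h \<longleftrightarrow> w \<in> gen_ideal f g h"
proof -
  obtain c where c: "v - w = h * c" using assms by (rule dvdE)
  have "v = w + c * h" "w = v + (- c) * h" using c by (simp_all add: algebra_simps)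
  thus ?thesis using gen_ideal_add gen_ideal_mult gen_ideal_gens(3) by metis
qed

text \<open>The preimage ideal contains the modulus, so passing to cosets loses nothing. This reduces all
  statements about codes to ordinary arithmetic of polynomials.\<close>

lemma code_generated_eq:
  "code_generated n a {f, g} = residue_class n a ` gen_ideal f g (xpow_minus n a)"
proof -
  let ?R = "ring_of_type_algebra :: 'a poly ring"
  let ?I = "modulus_ideal n a"
  let ?Q = "constacyclic_ring n a"
  let ?J = "gen_ideal f g (xpow_minus n a)"
  interpret R: cring ?R by (rule cring_from_type_algebra)
  have sel: "carrier ?R = UNIV" "\<And>x y. x \<oplus>\<^bsub>?R\<^esub> y = x + y" "\<And>x y. x \<otimes>\<^bsub>?R\<^esub> y = x * y" "\<zero>\<^bsub>?R\<^esub> = 0"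
    by (simp_all add: ring_of_type_algebra_def)
  interpret I: ideal ?I ?R
    unfolding modulus_ideal_def by (rule R.cgenideal_ideal) (simp add: sel)
  interpret Q: ring ?Q unfolding constacyclic_ring_def by (rule I.quotient_is_ring)
  have hom: "ring_hom_ring ?R ?Q (residue_class n a)"
    unfolding constacyclic_ring_def residue_class_def[abs_def]
    by (rule I.rcos_ring_hom_ring)
  interpret h: ring_hom_ring ?R ?Q "residue_class n a" by (rule hom)
  have J: "ideal ?J ?R"
  proof (rule idealI)
    show "subgroup ?J (add_monoid ?R)"
    proof (rule R.add.subgroupI)
      show "?J \<noteq> {}" using gen_ideal_gens(1) by blast
      fix x assume x: "x \<in> ?J"
      have "\<ominus>\<^bsub>?R\<^esub> x = - 1 * x"
        by (rule R.minus_equality) (simp_all add: sel)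
      thus "\<ominus>\<^bsub>?R\<^esub> x \<in> ?J"
        using gen_ideal_mult[OF x, of "-1"] by simp
      fix y assume y: "y \<in> ?J"
      show "x \<oplus>\<^bsub>?R\<^esub> y \<in> ?J" using gen_ideal_add[OF x y] by (simp add: sel)
    qed (simp add: sel)
    fix v x assume v: "v \<in> ?J"
    show "x \<otimes>\<^bsub>?R\<^esub> v \<in> ?J" using gen_ideal_mult[OF v, of x] by (simp add: sel)
    thus "v \<otimes>\<^bsub>?R\<^esub> x \<in> ?J" by (simp add: sel mult.commute)
  qed (rule R.ring_axioms)
  have "ideal (residue_class n a ` ?J) ?Q"
    using R.ring_ideal_imp_quot_ideal[OF I.ideal_axioms J]
    unfolding constacyclic_ring_def residue_class_def[abs_def] .
  hence le: "code_generated n a {f, g} \<subseteq> residue_class n a ` ?J"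
    unfolding code_generated_def by (rule Q.genideal_minimal) (auto intro: gen_ideal_gens)
  have carr: "residue_class n a ` S \<subseteq> carrier ?Q" for S
    by (auto simp: carrier_constacyclic_ring)
  interpret C: ideal "code_generated n a {f, g}" ?Q
    unfolding code_generated_def by (rule Q.genideal_ideal[OF carr])
  have gen: "residue_class n a f \<in> code_generated n a {f, g}"
     "residue_class n a g \<in> code_generated n a {f, g}"
    using Q.genideal_self[OF carr, of "{f, g}"] unfolding code_generated_def by auto
  have "residue_class n a w \<in> code_generated n a {f, g}" if w_in: "w \<in> ?J" for w
  proof -
    obtain x y z where w: "w = x * f + y * g + z * xpow_minus n a"
      using w_in unfolding gen_ideal_def by blast
    have "xpow_minus n a dvd w - (x * f + y * g)" unfolding w by (simp del: mult_minus_right)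
    hence "residue_class n a w = residue_class n a (x * f + y * g)"
      by (simp only: residue_class_eq_iff)
    also have "\<dots> = residue_class n a x \<otimes>\<^bsub>?Q\<^esub> residue_class n a f
        \<oplus>\<^bsub>?Q\<^esub> residue_class n a y \<otimes>\<^bsub>?Q\<^esub> residue_class n a g"
      using h.hom_add[of "x * f" "y * g"] h.hom_mult[of x f] h.hom_mult[of y g] by (simp add: sel)
    also have "\<dots> \<in> code_generated n a {f, g}"
      by (intro C.a_closed C.I_l_closed gen) (auto simp: carrier_constacyclic_ring)
    finally show ?thesis .
  qed
  thus ?thesis using le by blast
qed

lemma residue_class_in_code_generated_iff:
  "residue_class n a w \<in> code_generated n a {f, g} \<longleftrightarrow> w \<in> gen_ideal f g (xpow_minus n a)"
  unfolding code_generated_eq using gen_ideal_cong residue_class_eq_iff by blast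

text \<open>The case of two equal generators.\<close>

lemma residue_class_in_principal_code_iff:
  "residue_class n a f \<in> code_generated n a {g} \<longleftrightarrow> (\<exists>h. xpow_minus n a dvd f - h * g)"
proof -
  have "residue_class n a f \<in> code_generated n a {g} \<longleftrightarrow> f \<in> gen_ideal g g (xpow_minus n a)"
    using residue_class_in_code_generated_iff[of n a f g g] by simp
  also have "\<dots> \<longleftrightarrow> (\<exists>h. xpow_minus n a dvd f - h * g)"
  proof
    assume "f \<in> gen_ideal g g (xpow_minus n a)"
    then obtain x y z where f: "f = x * g + y * g + z * xpow_minus n a"
      unfolding gen_ideal_def by blast
    have "f - (x + y) * g = z * xpow_minus n a" unfolding f distrib_right by simp
    thus "\<exists>h. xpow_minus n a dvd f - h * g" by (metis dvd_triv_right)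
  next
    assume "\<exists>h. xpow_minus n a dvd f - h * g"
    thus "f \<in> gen_ideal g g (xpow_minus n a)"
      using gen_ideal_cong gen_ideal_mult[OF gen_ideal_gens(1)] by blast
  qed
  finally show ?thesis .
qed

lemma vec_class_representative:
  assumes "n > 0"
  obtains c where "c \<in> carrier_vec n" "xpow_minus n a dvd f - vec_poly c"
proof -
  have "residue_class n a f \<in> vec_class n a ` carrier_vec n"
    using bij_betw_vec_class[OF assms, of a] by (auto simp: bij_betw_def carrier_constacyclic_ring)
  thus ?thesis using that by (auto simp: vec_class_def residue_class_eq_iff)
qed

section \<open>The substitution of 1/x for x\<close>

text \<open>When \<open>a * b = 1\<close>, the monomial \<open>b x ^ (n - 1)\<close> represents the inverse of \<open>x\<close> in
  \<open>R[x] / (x ^ n - a)\<close>, so this is \<open>f(1 / x)\<close> without negative exponents.\<close>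

definition subst_recip :: "nat \<Rightarrow> 'r::comm_ring_1 \<Rightarrow> 'r poly \<Rightarrow> 'r poly" where
  "subst_recip n b f = pcompose f (Polynomial.monom b (n - 1))"

lemma subst_recip_simps:
  "subst_recip n b (f + g) = subst_recip n b f + subst_recip n b g"
  "subst_recip n b (f - g) = subst_recip n b f - subst_recip n b g"
  "subst_recip n b (f * g) = subst_recip n b f * subst_recip n b g"
  "subst_recip n b [:c:] = [:c:]"
  by (simp_all add: subst_recip_def pcompose_add pcompose_diff pcompose_mult)

lemma subst_recip_power: "subst_recip n b (f ^ k) = subst_recip n b f ^ k"
  by (induction k) (simp_all add: subst_recip_simps subst_recip_def pcompose_1 pcompose_mult)

lemma subst_recip_monom: "subst_recip n b (Polynomial.monom c k) = [:c:] * Polynomial.monom b (n - 1) ^ k"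
proof -
  have "subst_recip n b (Polynomial.monom 1 1) = Polynomial.monom b (n - 1)"
    by (simp add: subst_recip_def monom_altdef pcompose_pCons)
  moreover have "Polynomial.monom c k = [:c:] * Polynomial.monom 1 1 ^ k"
    by (simp add: monom_power smult_monom)
  ultimately show ?thesis by (simp only: subst_recip_simps subst_recip_power)
qed

lemma dvd_power_diff: "x - y dvd x ^ k - (y :: 'r::comm_ring_1) ^ k"
  by (simp add: power_diff_sumr2)

lemma x_subst_recip_cong_1:
  assumes "a * b = 1" "n > 0"
  shows "xpow_minus n a dvd Polynomial.monom 1 1 * Polynomial.monom b (n - 1) - 1"
proof -
  have "Polynomial.monom 1 1 * Polynomial.monom b (n - 1) - 1 = xpow_minus n a * [:b:]"
    using assms by (simp add: mult_monom smult_diff_right smult_monom one_pCons mult.commute del: mult_minus_left mult_minus_right)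
  thus ?thesis by (metis dvd_triv_left)
qed

text \<open>Since \<open>x ^ n = a\<close>, the \<open>n\<close>-th power of \<open>1 / x\<close> is \<open>b\<close>. Hence the substitution induces a map
  from \<open>R[x] / (x ^ n - b)\<close> to \<open>R[x] / (x ^ n - a)\<close>.\<close>

lemma subst_recip_xpow_minus:
  assumes ab: "a * b = 1" and n: "n > 0"
  shows "xpow_minus n a dvd subst_recip n b (xpow_minus n b)"
proof -
  define xx y where "xx = Polynomial.monom (1::'a) 1" and "y = Polynomial.monom b (n - 1)"
  define M where "M = xpow_minus n a"
  have M: "xx ^ n - [:a:] = M" by (simp add: M_def xx_def monom_power)
  have "[:a:] * [:b:] = 1" using ab by (simp add: one_pCons mult.commute)
  moreover have "Y - B = B * ((Z * Y - 1) - (Z - A) * Y)" if "A * B = 1" for A B Y Z :: "'a poly"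
  proof -
    have "B * ((Z * Y - 1) - (Z - A) * Y) = (A * B) * Y - B" by (simp add: algebra_simps)
    thus ?thesis unfolding that by simp
  qed
  moreover have "subst_recip n b (xpow_minus n b) = y ^ n - [:b:]"
    by (simp only: subst_recip_simps subst_recip_monom y_def) (simp flip: one_pCons)
  ultimately have "subst_recip n b (xpow_minus n b) = [:b:] * (((xx * y) ^ n - 1 ^ n) - (xx ^ n - [:a:]) * y ^ n)"
    unfolding power_mult_distrib power_one by metis
  moreover have "M dvd (xx * y) ^ n - 1 ^ n"
    using x_subst_recip_cong_1[OF assms] dvd_power_diff dvd_trans unfolding M_def xx_def y_def by blast
  ultimately show ?thesis unfolding M_def[symmetric] M by (simp del: mult_pCons_left mult_pCons_right)
qed

text \<open>Doing the substitution for \<open>b\<close> and then the one for \<open>a\<close> replaces \<open>x\<close> by a polynomial that is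
  congruent to \<open>x\<close>, so the induced maps between the two quotient rings are inverse to each other.\<close>

lemma subst_recip_involution:
  assumes ab: "a * b = 1" and n: "n > 0"
  shows "xpow_minus n b dvd subst_recip n a (subst_recip n b f) - f"
proof -
  define xx z where "xx = Polynomial.monom (1::'a) 1" and "z = Polynomial.monom a (n - 1)"
  define M where "M = xpow_minus n b"
  define y where "y = pcompose (Polynomial.monom b (n - 1)) z"
  have ba: "b * a = 1" using ab by (simp add: mult.commute)
  have y: "y = [:b:] * z ^ (n - 1)"
    using subst_recip_monom[of n a b "n - 1"] by (simp add: y_def z_def subst_recip_def)
  have d1: "M dvd xx * z - 1"
    using x_subst_recip_cong_1[OF ba n] by (simp add: M_def xx_def z_def)
  have d2: "M dvd z ^ n - [:a:]"
    using subst_recip_xpow_minus[OF ba n]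
    by (simp only: subst_recip_simps subst_recip_monom z_def[symmetric] M_def) (simp flip: one_pCons)
  \<comment> \<open>With \<open>z = 1 / x\<close> and \<open>z ^ n = a\<close>: \<open>y = b z ^ (n - 1) = b z ^ n x = b a x = x\<close>.\<close>
  have dy: "M dvd y - xx"
  proof -
    have c: "[:b:] * [:a:] = 1" using ab by (simp add: one_pCons)
    have zn: "z ^ n = z * z ^ (n - 1)" using n by (metis power_eq_if less_not_refl)
    have "y - xx = [:b:] * xx * (z ^ n - [:a:]) - [:b:] * z ^ (n - 1) * (xx * z - 1) + ([:b:] * [:a:] - 1) * xx"
    proof -
      have "B * Y - x = B * x * (w * Y - A) - B * Y * (x * w - 1) + (B * A - 1) * x"
        for A B Y w x :: "'a poly" by (simp add: algebra_simps)
      thus ?thesis unfolding y zn .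
    qed
    thus ?thesis using d1 d2 unfolding c by (simp del: mult_pCons_left mult_pCons_right)
  qed
  have "M dvd pcompose f y - f"
  proof (induction f)
    case (pCons c f)
    have "pCons c f = [:c:] + xx * f" by (simp add: xx_def monom_altdef)
    hence "pcompose (pCons c f) y - pCons c f = ([:c:] + y * pcompose f y) - ([:c:] + xx * f)"
      by (metis pcompose_pCons)
    also have "\<dots> = y * (pcompose f y - f) + (y - xx) * f" by (simp add: algebra_simps)
    finally have "pcompose (pCons c f) y - pCons c f = y * (pcompose f y - f) + (y - xx) * f" .
    thus ?case using pCons dy by simp
  qed simp
  thus ?thesis unfolding y_def M_def z_def subst_recip_def by (simp add: pcompose_assoc)
qed

text \<open>In the quotient ring, \<open>x ^ (-k) - e' = - e' x ^ (-k) (x ^ k - e)\<close>: the factor with root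
  parameter \<open>e'\<close> becomes a unit times the one with the inverse parameter \<open>e\<close>.\<close>

lemma subst_recip_root_factor:
  assumes ab: "a * b = 1" and n: "n > 0" and e: "e * e' = 1"
  shows "xpow_minus n a dvd subst_recip n b (xpow_minus k e') - [:- e':] * Polynomial.monom b (n - 1) ^ k * xpow_minus k e"
proof -
  define xx y where "xx = Polynomial.monom (1::'a) 1" and "y = Polynomial.monom b (n - 1)"
  have c: "[:e':] * [:e:] = 1" using e by (simp add: one_pCons mult.commute)
  have "subst_recip n b (xpow_minus k e') - [:- e':] * y ^ k * (xx ^ k - [:e:])
     = y ^ k - [:e':] - (- [:e':]) * y ^ k * (xx ^ k - [:e:])"
    by (simp add: subst_recip_simps subst_recip_monom y_def flip: one_pCons)
  also have "\<dots> = [:e':] * ((xx * y) ^ k - 1 ^ k) - ([:e':] * [:e:] - 1) * y ^ k"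
  proof -
    have "Y - E' - (- E') * Y * (Z - E) = E' * (Z * Y - 1) - (E' * E - 1) * Y"
      for Y Z E E' :: "'a poly" by (simp add: algebra_simps)
    thus ?thesis unfolding power_mult_distrib power_one .
  qed
  also have "\<dots> = [:e':] * ((xx * y) ^ k - 1 ^ k)" unfolding c by simp
  finally have eq: "subst_recip n b (xpow_minus k e') - [:- e':] * y ^ k * (xx ^ k - [:e:])
     = [:e':] * ((xx * y) ^ k - 1 ^ k)" .
  have xk: "xx ^ k = Polynomial.monom 1 k" by (simp add: xx_def monom_power)
  have "xpow_minus n a dvd (xx * y) ^ k - 1 ^ k"
    using x_subst_recip_cong_1[OF ab n] dvd_power_diff dvd_trans unfolding xx_def y_def by blast
  hence "xpow_minus n a dvd subst_recip n b (xpow_minus k e') - [:- e':] * y ^ k * (xx ^ k - [:e:])"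
    unfolding eq by (rule dvd_mult)
  thus ?thesis unfolding xk y_def .
qed

text \<open>It suffices to check each of the three generators: the power of \<open>x ^ k - e'\<close> becomes a multiple
  of the power of \<open>x ^ k - e\<close>, the constant is fixed, and the modulus becomes \<open>0\<close>.\<close>

lemma subst_recip_gen_ideal:
  assumes ab: "a * b = 1" and n: "n > 0" and e: "e * e' = 1"
    and f: "f \<in> gen_ideal (xpow_minus k e' ^ j) [:c:] (xpow_minus n b)"
  shows "subst_recip n b f \<in> gen_ideal (xpow_minus k e ^ j) [:c:] (xpow_minus n a)"
proof -
  let ?J = "gen_ideal (xpow_minus k e ^ j) [:c:] (xpow_minus n a)" and ?s = "subst_recip n b"
  obtain x y z where fx: "f = x * xpow_minus k e' ^ j + y * [:c:] + z * xpow_minus n b"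
    using f unfolding gen_ideal_def by blast
  define t where "t = [:- e':] * Polynomial.monom b (n - 1) ^ k"
  have "xpow_minus n a dvd ?s (xpow_minus k e' ^ j) - (t * xpow_minus k e) ^ j"
    using subst_recip_root_factor[OF ab n e, of k] dvd_power_diff dvd_trans
    unfolding t_def[symmetric] subst_recip_power by blast
  hence 1: "?s (xpow_minus k e' ^ j) \<in> ?J"
    using gen_ideal_mult[OF gen_ideal_gens(1)] by (simp only: gen_ideal_cong power_mult_distrib)
  have 2: "?s [:c:] \<in> ?J" unfolding subst_recip_simps by (rule gen_ideal_gens)
  have "xpow_minus n a dvd ?s (xpow_minus n b) - 0" using subst_recip_xpow_minus[OF ab n] by simp
  hence 3: "?s (xpow_minus n b) \<in> ?J"
    using gen_ideal_mult[OF gen_ideal_gens(1), of 0] by (simp only: gen_ideal_cong mult_zero_left)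
  show ?thesis unfolding fx
    by (simp only: subst_recip_simps(1,3)) (intro gen_ideal_add gen_ideal_mult 1 2 3)
qed

lemma subst_recip_gen_ideal_iff:
  assumes ab: "a * b = 1" and n: "n > 0" and e: "e * e' = 1"
  shows "subst_recip n b f \<in> gen_ideal (xpow_minus k e ^ j) [:c:] (xpow_minus n a)
     \<longleftrightarrow> f \<in> gen_ideal (xpow_minus k e' ^ j) [:c:] (xpow_minus n b)"
proof
  assume "subst_recip n b f \<in> gen_ideal (xpow_minus k e ^ j) [:c:] (xpow_minus n a)"
  moreover have "b * a = 1" "e' * e = 1" using ab e by (simp_all add: mult.commute)
  ultimately have "subst_recip n a (subst_recip n b f) \<in> gen_ideal (xpow_minus k e' ^ j) [:c:] (xpow_minus n b)"
    using n subst_recip_gen_ideal by blast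
  thus "f \<in> gen_ideal (xpow_minus k e' ^ j) [:c:] (xpow_minus n b)"
    using gen_ideal_cong[OF subst_recip_involution[OF ab n]] by blast
qed (rule subst_recip_gen_ideal[OF assms])

section \<open>The dual code as an annihilator\<close>

definition lin_form :: "(nat \<Rightarrow> 'r::comm_ring_1) \<Rightarrow> 'r poly \<Rightarrow> 'r" where
  "lin_form t f = (\<Sum>i\<le>Polynomial.degree f. Polynomial.coeff f i * t i)"

lemma lin_form_bound:
  "Polynomial.degree f \<le> N \<Longrightarrow> lin_form t f = (\<Sum>i\<le>N. Polynomial.coeff f i * t i)"
  unfolding lin_form_def by (rule sum.mono_neutral_left) (auto simp: coeff_eq_0)

lemma lin_form_add: "lin_form t (f + g) = lin_form t f + lin_form t g"
proof -
  let ?N = "max (Polynomial.degree f) (Polynomial.degree g)"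
  have "Polynomial.degree (f + g) \<le> ?N" by (rule degree_add_le_max)
  thus ?thesis
    by (simp add: lin_form_bound[of _ ?N] distrib_right sum.distrib)
qed

lemma lin_form_monom: "lin_form t (Polynomial.monom c k) = c * t k"
proof -
  have "lin_form t (Polynomial.monom c k) = (\<Sum>i\<le>k. if i = k then c * t k else 0)"
    unfolding lin_form_bound[OF degree_monom_le] by (rule sum.cong) auto
  thus ?thesis by simp
qed

lemma lin_form_0: "lin_form t 0 = 0"
  by (simp add: lin_form_def)

lemma lin_form_sum: "lin_form t (\<Sum>i\<in>A. f i) = (\<Sum>i\<in>A. lin_form t (f i))"
  by (induction A rule: infinite_finite_induct) (simp_all add: lin_form_add lin_form_0)

text \<open>The constant coefficient of the remainder of \<open>f\<close> modulo \<open>x ^ n - a\<close>: reducing \<open>x ^ i\<close> gives a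
  constant, namely \<open>a ^ (i div n)\<close>, just when \<open>n\<close> divides \<open>i\<close>. In this form linearity is
  immediate and no division with remainder is involved.\<close>

definition const_coeff :: "nat \<Rightarrow> 'r::comm_ring_1 \<Rightarrow> 'r poly \<Rightarrow> 'r" where
  "const_coeff n a = lin_form (\<lambda>i. if n dvd i then a ^ (i div n) else 0)"

lemma const_coeff_xpow_minus_mult:
  assumes "n > 0"
  shows "const_coeff n a (xpow_minus n a * f) = 0"
proof -
  have m: "const_coeff n a (xpow_minus n a * Polynomial.monom c i) = 0" for c i
  proof -
    have "xpow_minus n a * Polynomial.monom c i = Polynomial.monom c (n + i) + Polynomial.monom (- (a * c)) i"
      by (simp add: left_diff_distrib mult_monom smult_monom minus_monom)
    thus ?thesis using assms by (simp add: const_coeff_def lin_form_add lin_form_monom)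
  qed
  have "xpow_minus n a * f = (\<Sum>i\<le>Polynomial.degree f. xpow_minus n a * Polynomial.monom (Polynomial.coeff f i) i)"
    by (subst poly_as_sum_of_monoms[of f, symmetric]) (simp only: sum_distrib_left)
  thus ?thesis using m unfolding const_coeff_def by (simp add: lin_form_sum)
qed

lemma const_coeff_cong:
  assumes "n > 0" "xpow_minus n a dvd f - g"
  shows "const_coeff n a f = const_coeff n a g"
proof -
  obtain h where "f - g = xpow_minus n a * h" using assms(2) by (rule dvdE)
  hence "f = g + xpow_minus n a * h" by (metis diff_add_cancel add.commute)
  thus ?thesis using const_coeff_xpow_minus_mult[OF assms(1), of a h]
    unfolding const_coeff_def by (simp add: lin_form_add)
qed

text \<open>For \<open>i, j < n\<close> the monomial \<open>x ^ i * x ^ (-j)\<close> has constant coefficient \<open>1\<close> if \<open>i = j\<close> and \<open>0\<close>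
  otherwise, so only the diagonal of the product of the two sums contributes.\<close>

lemma scalar_prod_eq_const_coeff:
  assumes ab: "a * b = 1" and n: "n > 0" and c: "c \<in> carrier_vec n" and d: "d \<in> carrier_vec n"
  shows "c \<bullet> d = const_coeff n a (vec_poly c * subst_recip n b (vec_poly d))"
proof -
  have m: "const_coeff n a (Polynomial.monom x i * subst_recip n b (Polynomial.monom y j)) = (if i = j then x * y else 0)"
    if "i < n" "j < n" for x y i j
  proof -
    have eq: "Polynomial.monom x i * subst_recip n b (Polynomial.monom y j) = Polynomial.monom (x * y * b ^ j) (i + (n - 1) * j)"
      by (simp add: subst_recip_monom monom_power mult_monom smult_monom mult_ac)
    \<comment> \<open>The exponent of \<open>x ^ i (b x ^ (n - 1)) ^ j\<close> is \<open>i - j\<close> modulo \<open>n\<close>.\<close>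
    have e: "i + (n - 1) * j + j = i + n * j" using n
      by (cases n) (simp_all)
    have "n dvd i + (n - 1) * j \<longleftrightarrow> i = j"
    proof
      assume "n dvd i + (n - 1) * j"
      hence "(i + (n - 1) * j + j) mod n = j mod n" by (metis dvd_imp_mod_0 mod_add_left_eq add_0)
      hence "i mod n = j mod n" unfolding e by simp
      thus "i = j" using that by simp
    next
      assume "i = j"
      hence "i + (n - 1) * j = n * j" using e by simp
      thus "n dvd i + (n - 1) * j" by simp
    qed
    moreover have "(i + (n - 1) * j) div n = j" if "i = j"
    proof -
      have "i + (n - 1) * j = n * j" using e that by simp
      thus ?thesis using n by simp
    qed
    moreover have "b ^ j * a ^ j = 1" using ab by (metis power_mult_distrib mult.commute power_one)
    ultimately show ?thesis unfolding eq const_coeff_def lin_form_monom by (simp add: mult.assoc)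
  qed
  have "vec_poly c * subst_recip n b (vec_poly d)
    = (\<Sum>i<n. \<Sum>j<n. Polynomial.monom (c $ i) i * subst_recip n b (Polynomial.monom (d $ j) j))"
    using c d by (simp add: vec_poly_def subst_recip_def pcompose_sum sum_product)
  hence "const_coeff n a (vec_poly c * subst_recip n b (vec_poly d))
    = (\<Sum>i<n. \<Sum>j<n. if i = j then c $ i * d $ j else 0)"
    unfolding const_coeff_def by (simp add: lin_form_sum m[unfolded const_coeff_def])
  also have "\<dots> = (\<Sum>i<n. c $ i * d $ i)" by simp
  finally show ?thesis using d by (simp add: scalar_prod_def lessThan_atLeast0)
qed

text \<open>If \<open>g(x) d(1 / x) = 0\<close>, the inner product of \<open>d\<close> with every multiple of \<open>g\<close> is \<open>0\<close>. For the
  converse let \<open>r\<close> be the remainder of \<open>g(x) d(1 / x)\<close>. Its coefficient at \<open>x ^ i\<close> is the constant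
  coefficient of \<open>r x ^ (-i)\<close>, which is the inner product of \<open>d\<close> with the codeword
  \<open>x ^ (-i) g\<close>, so it vanishes.\<close>

lemma dual_code_iff_annihilates:
  assumes ab: "a * b = 1" and n: "n > 0" and d: "d \<in> carrier_vec n"
    and C: "\<And>f. residue_class n a f \<in> C \<longleftrightarrow> (\<exists>h. xpow_minus n a dvd f - h * g)"
  shows "d \<in> dual_code n (codewords n a C) \<longleftrightarrow> xpow_minus n a dvd g * subst_recip n b (vec_poly d)"
proof
  let ?s = "subst_recip n b" and ?M = "xpow_minus n a"
  note prod = scalar_prod_eq_const_coeff[OF ab n]
  {
    assume dvd: "?M dvd g * ?s (vec_poly d)"
    have "c \<bullet> d = 0" if c: "c \<in> codewords n a C" for c
    proof -
      have cn: "c \<in> carrier_vec n" using c by (simp add: codewords_def)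
      obtain h where h: "?M dvd vec_poly c - h * g"
        using c C by (auto simp: codewords_def vec_class_def)
      have "?M dvd (vec_poly c - h * g) * ?s (vec_poly d) + h * (g * ?s (vec_poly d))"
        using h dvd by simp
      hence "?M dvd vec_poly c * ?s (vec_poly d) - 0" by (simp add: algebra_simps)
      thus ?thesis using const_coeff_cong[OF n, of a _ 0] prod[OF cn d]
        by (simp add: const_coeff_def lin_form_0)
    qed
    thus "d \<in> dual_code n (codewords n a C)" using d by (simp add: dual_code_def)
  }
  assume dual: "d \<in> dual_code n (codewords n a C)"
  obtain r where r: "r \<in> carrier_vec n" and rd: "?M dvd g * ?s (vec_poly d) - vec_poly r"
    using vec_class_representative[OF n] .
  have "r $ i = 0" if i: "i < n" for i
  proof -
    let ?y = "?s (Polynomial.monom 1 i)"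
    obtain c where c: "c \<in> carrier_vec n" and cd: "?M dvd ?y * g - vec_poly c"
      using vec_class_representative[OF n] .
    have "?M dvd vec_poly c - ?y * g" using cd by (metis dvd_minus_iff minus_diff_eq)
    hence "c \<in> codewords n a C" using c C by (auto simp: codewords_def vec_class_def)
    hence "0 = c \<bullet> d" using dual by (simp add: dual_code_def)
    also have "\<dots> = const_coeff n a (vec_poly c * ?s (vec_poly d))" by (rule prod[OF c d])
    also have "\<dots> = const_coeff n a (vec_poly r * ?y)"
    proof (rule const_coeff_cong[OF n])
      have "vec_poly c * ?s (vec_poly d) - vec_poly r * ?y
        = (g * ?s (vec_poly d) - vec_poly r) * ?y - (?y * g - vec_poly c) * ?s (vec_poly d)"
        by (simp add: algebra_simps)
      thus "?M dvd vec_poly c * ?s (vec_poly d) - vec_poly r * ?y" using cd rd by simp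
    qed
    also have "\<dots> = r \<bullet> unit_vec n i"
    proof -
      have "vec_poly (unit_vec n i :: 'a vec) = Polynomial.monom 1 i"
        by (rule poly_eqI) (use i in \<open>auto simp: coeff_vec_poly unit_vec_def\<close>)
      thus ?thesis using prod[OF r, of "unit_vec n i"] by simp
    qed
    also have "\<dots> = r $ i" using i r by simp
    finally show ?thesis by simp
  qed
  hence "vec_poly r = 0" using r by (simp add: vec_poly_def)
  thus "?M dvd g * ?s (vec_poly d)" using rd by simp
qed

section \<open>Polynomials over F[u,v] / (u^2, v^2)\<close>

abbreviation emb :: "'a::comm_ring_1 poly \<Rightarrow> 'a uv_ring poly" where
  "emb \<equiv> map_poly embed"

lemma embed_hom:
  "embed 0 = (0 :: 'a::comm_ring_1 uv_ring)" "embed 1 = (1 :: 'a uv_ring)"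
  "embed (x + y) = embed x + (embed y :: 'a uv_ring)"
  "embed (x - y) = embed x - (embed y :: 'a uv_ring)"
  "embed (x * y) = embed x * (embed y :: 'a uv_ring)"
  by (transfer, simp add: uv_rel_refl one_pCons)+

lemma emb_add: "emb (f + g) = emb f + emb g"
  by (rule poly_eqI) (simp add: coeff_map_poly embed_hom)

lemma emb_diff: "emb (f - g) = emb f - emb g"
  by (rule poly_eqI) (simp add: coeff_map_poly embed_hom)

lemma emb_const: "emb [:c:] = [:embed c:]"
  by (simp add: map_poly_pCons embed_hom)

lemma emb_mult: "emb (f * g) = emb f * emb g"
proof (induction f)
  case (pCons a f)
  have "emb (smult a g) = smult (embed a) (emb g)"
    by (simp add: map_poly_smult embed_hom)
  thus ?case using pCons by (simp add: emb_add map_poly_pCons embed_hom)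
qed simp

lemma emb_power: "emb (f ^ k) = emb f ^ k"
  by (induction k) (simp_all add: emb_mult embed_hom)

text \<open>This and the next lemma say that \<open>R[x]\<close> is a free module over \<open>F[x]\<close> with basis
  \<open>1, u, v, u v\<close>; both follow coefficientwise from the normal form in \<open>R\<close>.\<close>

lemma emb_decomposition:
  obtains a b c d where "f = emb a + emb b * [:uu:] + emb c * [:vv:] + emb d * [:uu * vv:]"
proof -
  have "\<exists>a b c d. f = emb a + emb b * [:uu:] + emb c * [:vv:] + emb d * [:uu * vv:]"
  proof (induction f)
    case 0
    show ?case by (intro exI[of _ 0]) simp
  next
    case (pCons x f)
    then obtain a b c d where f: "f = emb a + emb b * [:uu:] + emb c * [:vv:] + emb d * [:uu * vv:]"
      by blast
    obtain a' b' c' d' where x: "x = embed a' + embed b' * uu + embed c' * vv + embed d' * uu * vv"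
      using uv_ring_normal_form[of x] by auto
    show ?case
      by (rule exI[of _ "pCons a' a"], rule exI[of _ "pCons b' b"], rule exI[of _ "pCons c' c"],
          rule exI[of _ "pCons d' d"])
        (rule poly_eqI, simp add: f x coeff_map_poly embed_hom coeff_pCons mult.commute mult.left_commute split: nat.split)
  qed
  thus ?thesis using that by blast
qed

lemma emb_decomposition_unique:
  assumes "emb a + emb b * [:uu:] + emb c * [:vv:] + emb d * [:uu * vv:]
         = emb a' + emb b' * [:uu:] + emb c' * [:vv:] + emb d' * [:uu * vv:]"
  shows "a = a' \<and> b = b' \<and> c = c' \<and> d = d'"
proof -
  have "Polynomial.coeff a i = Polynomial.coeff a' i \<and> Polynomial.coeff b i = Polynomial.coeff b' i
    \<and> Polynomial.coeff c i = Polynomial.coeff c' i \<and> Polynomial.coeff d i = Polynomial.coeff d' i" for i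
  proof -
    let ?c = "\<lambda>f. Polynomial.coeff f i"
    let ?x = "embed (?c a) + embed (?c b) * uu + embed (?c c) * vv + embed (?c d) * uu * vv"
    have "?x = embed (?c a') + embed (?c b') * uu + embed (?c c') * vv + embed (?c d') * uu * vv"
      using arg_cong[OF assms, of "\<lambda>f. Polynomial.coeff f i"]
      by (simp add: coeff_map_poly embed_hom mult_ac)
    hence "(?c a, ?c b, ?c c, ?c d) = (?c a', ?c b', ?c c', ?c d')"
      by (intro Uniq_D[OF uv_ring_normal_form[of ?x, unfolded ex1_iff_ex_Uniq, THEN conjunct2]]) (simp_all only: prod.case)
    thus ?thesis by simp
  qed
  thus ?thesis by (simp add: poly_eq_iff)
qed

text \<open>Put \<open>M = N - w\<close> with \<open>w = a2 u + a3 v + a4 u v\<close>. One inclusion holds because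
  \<open>A u B = u N ^ 2\<close> and \<open>u (N ^ 2 - a3 ^ 2 v ^ 2) = u (N - a3 v) (N + a3 v)\<close> is a multiple of
  \<open>M\<close>. For the other one, write \<open>A u f = M k\<close> in coordinates over \<open>F[x]\<close>: the coordinates of \<open>k\<close>
  at \<open>1\<close> and \<open>v\<close> vanish, and those at \<open>u\<close> and \<open>u v\<close> give
  \<open>A f0 = N k1\<close> and \<open>A f2 = N k3 - a3 k1\<close>. Eliminating \<open>k1\<close> and cancelling \<open>A\<close> leaves
  \<open>a3 f0 + N f2 = B k3\<close>. Modulo \<open>u\<close> and \<open>M\<close> the left-hand side is \<open>a3 f0 + a3 v f2 = a3 f\<close>, so
  \<open>f\<close> is a multiple of \<open>B\<close> there.\<close>

lemma uv_annihilator: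
  fixes A B N :: "'a::field poly" and a2 a3 a4 :: 'a and f :: "'a uv_ring poly"
  defines "M \<equiv> emb N - [:embed a2 * uu + embed a3 * vv + embed a4 * uu * vv:]"
  assumes AB: "A * B = N ^ 2" and N: "N \<noteq> 0" and a3: "a3 \<noteq> 0"
  shows "M dvd emb A * [:uu:] * f \<longleftrightarrow> (\<exists>x y z. f = x * emb B + y * [:uu:] + z * M)"
proof -
  define U V :: "'a uv_ring poly" where "U = [:uu:]" and "V = [:vv:]"
  have U: "U * U = 0" and V: "V * V = 0"
    using uu_vv_relations by (simp_all add: U_def V_def power2_eq_square)
  have U': "U * (U * x) = 0" and V': "V * (V * x) = 0" for x
    using U V by (simp_all flip: mult.assoc)
  define c2 c3 c4 where "c2 = emb [:a2:]" and "c3 = emb [:a3:]" and "c4 = emb [:a4:]"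
  have UV: "[:uu * vv:] = U * V" by (simp add: U_def V_def)
  have M: "M = emb N - (c2 * U + c3 * V + c4 * U * V)"
    by (simp add: M_def U_def V_def c2_def c3_def c4_def emb_const)
  have A0: "A \<noteq> 0" using AB N by auto
  have unit: "emb [:inverse a3:] * c3 = 1"
    using a3 by (simp add: c3_def emb_const one_pCons flip: embed_hom)
  show ?thesis unfolding U_def[symmetric]
  proof
    assume "M dvd emb A * U * f"
    then obtain k where k: "emb A * U * f = M * k" by (rule dvdE)
    obtain f0 f1 f2 f3 where f: "f = emb f0 + emb f1 * U + emb f2 * V + emb f3 * (U * V)"
      using emb_decomposition[of f] unfolding UV U_def[symmetric] V_def[symmetric] by blast
    obtain k0 k1 k2 k3 where k': "k = emb k0 + emb k1 * U + emb k2 * V + emb k3 * (U * V)"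
      using emb_decomposition[of k] unfolding UV U_def[symmetric] V_def[symmetric] by blast
    have l: "emb A * U * f = emb 0 + emb (A * f0) * U + emb 0 * V + emb (A * f2) * (U * V)"
      unfolding f by (simp add: emb_mult algebra_simps U U')
    have r: "M * k = emb (N * k0) + emb (N * k1 - [:a2:] * k0) * U + emb (N * k2 - [:a3:] * k0) * V
       + emb (N * k3 - [:a2:] * k2 - [:a3:] * k1 - [:a4:] * k0) * (U * V)"
      unfolding M k' emb_mult emb_diff c2_def[symmetric] c3_def[symmetric] c4_def[symmetric]
      by (simp add: algebra_simps U V U' V')
    have e: "0 = N * k0 \<and> A * f0 = N * k1 - [:a2:] * k0 \<and> 0 = N * k2 - [:a3:] * k0
       \<and> A * f2 = N * k3 - [:a2:] * k2 - [:a3:] * k1 - [:a4:] * k0"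
      by (rule emb_decomposition_unique, unfold UV, fold U_def V_def, fold l r, rule k)
    have "k0 = 0" "k2 = 0" using e N by auto
    hence e1: "A * f0 = N * k1" and e2: "A * f2 = N * k3 - [:a3:] * k1" using e by auto
    have "A * (B * k3) = N * (N * k3)" using AB by (simp add: power2_eq_square flip: mult.assoc)
    also have "\<dots> = A * ([:a3:] * f0 + N * f2)"
    proof -
      have "A * ([:a3:] * f0 + N * f2) = [:a3:] * (A * f0) + N * (A * f2)"
        by (simp only: algebra_simps)
      also have "\<dots> = N * (N * k3)" unfolding e1 e2 by (simp only: algebra_simps)
      finally show ?thesis by simp
    qed
    finally have e3: "B * k3 = [:a3:] * f0 + N * f2" using A0 by simp
    have e4: "c3 * emb f0 = emb B * emb k3 - emb N * emb f2"
      using arg_cong[OF e3, of emb] unfolding emb_mult emb_add c3_def by (simp add: algebra_simps)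
    have "f = emb [:inverse a3:] * c3 * f" by (simp add: unit)
    also have "\<dots> = emb [:inverse a3:] * (c3 * emb f0 + c3 * emb f1 * U + c3 * emb f2 * V + c3 * emb f3 * (U * V))"
      by (simp only: f algebra_simps)
    also have "\<dots> = (emb [:inverse a3:] * emb k3) * emb B
       + (emb [:inverse a3:] * (c3 * emb f1 + c3 * emb f3 * V - c2 * emb f2 - c4 * V * emb f2)) * U
       + (- emb [:inverse a3:] * emb f2) * M"
      unfolding e4 M by (simp add: algebra_simps)
    finally show "\<exists>x y z. f = x * emb B + y * U + z * M" by blast
  next
    assume "\<exists>x y z. f = x * emb B + y * U + z * M"
    then obtain x y z where f: "f = x * emb B + y * U + z * M" by blast
    have AB0: "emb A * emb B = emb N * emb N" using AB by (simp add: power2_eq_square flip: emb_mult)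
    hence AB': "emb A * (emb B * t) = emb N * (emb N * t)" for t by (simp flip: mult.assoc)
    have "emb A * U * f = M * (U * x * (emb N + c3 * V) + z * emb A * U)"
      unfolding f M by (simp add: algebra_simps U V U' V' AB0 AB')
    thus "M dvd emb A * U * f" by simp
  qed
qed

text \<open>The element is \<open>c + w\<close> with \<open>c\<close> a unit and \<open>w ^ 3 = 0\<close>, and
  \<open>(c + w) (c ^ 2 - c w + w ^ 2) = c ^ 3 + w ^ 3\<close>. Exhibiting this inverse comes first,
  because \<open>inv\<close> is defined by description and meaningful only for units.\<close>

lemma uv_inverse:
  fixes \<alpha> :: "'a::field uv_ring"
  assumes "a1 \<noteq> 0" and \<alpha>: "\<alpha> = embed a1 + embed a2 * uu + embed a3 * vv + embed a4 * uu * vv"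
  shows "\<alpha> * inv\<^bsub>ring_of_type_algebra\<^esub> \<alpha> = 1"
proof -
  let ?R = "ring_of_type_algebra :: 'a uv_ring ring"
  interpret R: cring ?R by (rule cring_from_type_algebra)
  define c d :: "'a uv_ring" where "c = embed a1" and "d = embed (inverse a1)"
  define w where "w = embed a2 * uu + embed a3 * vv + embed a4 * uu * vv"
  have U: "uu * uu = (0 :: 'a uv_ring)" and V: "vv * vv = (0 :: 'a uv_ring)"
    using uu_vv_relations by (simp_all add: power2_eq_square)
  have U': "uu * (uu * x) = 0" and V': "vv * (vv * x) = 0" for x :: "'a uv_ring"
    using U V by (simp_all flip: mult.assoc)
  have w3: "w * w * w = 0" unfolding w_def by (simp add: algebra_simps U V U' V')
  have cd: "c * d = 1" using assms(1) by (simp add: c_def d_def flip: embed_hom)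
  have "\<alpha> = c + w" by (simp add: \<alpha> c_def w_def)
  hence "\<alpha> * ((c * c - c * w + w * w) * (d * d * d)) = (c * c * c + w * w * w) * (d * d * d)"
    by (simp add: algebra_simps)
  also have "\<dots> = (c * d) * (c * d) * (c * d)" unfolding w3 by (simp add: mult_ac)
  also have "\<dots> = 1" unfolding cd by simp
  finally have inv: "\<alpha> * ((c * c - c * w + w * w) * (d * d * d)) = 1" .
  have "\<alpha> \<in> Units ?R" unfolding Units_def
    using inv by (auto simp: ring_of_type_algebra_def mult.commute intro!: exI[of _ "(c * c - c * w + w * w) * (d * d * d)"])
  from R.Units_r_inv[OF this] show ?thesis by (simp add: ring_of_type_algebra_def)
qed

section \<open>Roots under the Frobenius map\<close>

text \<open>Multiplication by a nonzero \<open>x\<close> permutes the nonzero elements; compare their products.\<close>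

lemma power_card_eq_self:
  fixes x :: "'a::{field,finite}"
  shows "x ^ card (UNIV :: 'a set) = x"
proof (cases "x = 0")
  case True
  thus ?thesis by (simp add: card_gt_0_iff)
next
  case False
  let ?P = "\<Prod>y\<in>UNIV - {0::'a}. y"
  have "?P = (\<Prod>y\<in>UNIV - {0}. x * y)"
    by (rule prod.reindex_bij_witness[of _ "\<lambda>y. x * y" "\<lambda>y. y / x"]) (use False in auto)
  also have "\<dots> = x ^ (card (UNIV :: 'a set) - 1) * ?P"
    by (simp add: prod.distrib)
  finally have "x ^ (card (UNIV :: 'a set) - 1) = 1" by simp
  hence "x * x ^ (card (UNIV :: 'a set) - 1) = x" by simp
  thus ?thesis by (metis power_eq_if card_gt_0_iff finite UNIV_not_empty less_not_refl)
qed

lemma power_card_power_eq_self: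
  fixes x :: "'a::{field,finite}"
  shows "x ^ (card (UNIV :: 'a set) ^ k) = x"
  by (induction k) (simp_all add: power_card_eq_self power_mult)

lemma CHAR_eq_of_card:
  assumes "prime p" "card (UNIV :: 'a::{field,finite} set) = p ^ m"
  shows "CHAR('a) = p"
proof -
  have "prime CHAR('a)" by (rule prime_CHAR_semidom) (simp add: finite_imp_CHAR_pos)
  moreover have "CHAR('a) dvd p ^ m" using CHAR_dvd_CARD[where ?'a = 'a] assms by simp
  ultimately show ?thesis using assms(1) by (metis prime_dvd_power primes_dvd_imp_eq)
qed

text \<open>The exponents in \<open>a0 ^ (p ^ s)\<close> add up to \<open>m - r0 + s = m (q0 + 1)\<close>, and taking the
  \<open>p ^ m\<close>-th power is the identity on the field, so \<open>a0\<close> is a \<open>p ^ s\<close>-th root of \<open>a1\<close>. The rest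
  is additivity of the Frobenius map on polynomials.\<close>

lemma xpow_minus_frobenius:
  fixes a0 a1 :: "'a::{field,finite}"
  assumes p: "prime p" and card: "card (UNIV :: 'a set) = p ^ m"
    and s: "s = q0 * m + r0" and r0: "r0 \<le> m" and a0: "a0 = a1 ^ (p ^ (m - r0))"
  shows "xpow_minus k a0 ^ (p ^ s) = xpow_minus (k * p ^ s) a1"
proof -
  have "m - r0 + s = m * Suc q0" using s r0 by (simp add: algebra_simps)
  hence "a0 ^ (p ^ s) = a1 ^ ((p ^ m) ^ Suc q0)"
    unfolding a0 by (simp only: flip: power_mult power_add)
  hence root: "a0 ^ (p ^ s) = a1" using power_card_power_eq_self[of a1 "Suc q0"] card by simp
  have "CHAR('a poly) = p" using CHAR_eq_of_card[OF p card] by simp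
  \<comment> \<open>Applied to a sum rather than a difference, so that no sign \<open>(- 1) ^ (p ^ s)\<close> appears.\<close>
  hence "(xpow_minus k a0 + [:a0:]) ^ (p ^ s) = xpow_minus k a0 ^ (p ^ s) + [:a0:] ^ (p ^ s)"
    using p by (intro freshmans_dream') simp_all
  hence "Polynomial.monom 1 (k * p ^ s) = xpow_minus k a0 ^ (p ^ s) + [:a1:]"
    by (simp add: monom_power poly_const_pow root)
  thus ?thesis by (metis add_diff_cancel_right')
qed

section \<open>The dual of the code generated by u (x^3 - a)^l\<close>

theorem theorem5p3:
  fixes p m s q0 r0 l :: nat
    and \<alpha>1 \<alpha>2 \<alpha>3 \<alpha>4 \<alpha>0 :: "'a::{field,finite}"
    and \<alpha> \<beta> :: "'a uv_ring"
    and C :: "'a uv_ring poly set set"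
  assumes "prime p" and "p \<noteq> 3" and "m > 0" and "s > 0"
    and "card (UNIV :: 'a set) = p ^ m"
    and "s = q0 * m + r0" and "r0 \<le> m - 1"
    and "\<alpha>0 = \<alpha>1 ^ (p ^ (m - r0))"
    and "\<alpha>1 \<noteq> 0" and "\<alpha>2 \<noteq> 0" and "\<alpha>3 \<noteq> 0"
    and "\<alpha> = embed \<alpha>1 + embed \<alpha>2 * uu + embed \<alpha>3 * vv + embed \<alpha>4 * uu * vv"
    and "\<not> (\<exists>\<gamma>. \<alpha> = \<gamma> ^ 3)"
    and "\<beta> = inv\<^bsub>ring_of_type_algebra\<^esub> \<alpha>"
    and "l \<le> 2 * p ^ s - 1"
    and "C = code_generated (3 * p ^ s) \<alpha>
               {[:uu:] * (Polynomial.monom 1 3 - [:embed \<alpha>0:]) ^ l}"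
  shows "vec_class (3 * p ^ s) \<beta> ` dual_code (3 * p ^ s) (codewords (3 * p ^ s) \<alpha> C)
         = code_generated (3 * p ^ s) \<beta>
             {(Polynomial.monom 1 3 - [:embed (inverse \<alpha>0):]) ^ (2 * p ^ s - l), [:uu:]}"
proof -
  define q n where "q = p ^ s" and "n = 3 * q"
  define P where "P = Polynomial.monom 1 3 - [:\<alpha>0:]"
  have n: "n > 0" using assms(1) by (simp add: n_def q_def prime_gt_0_nat)
  have emb_xpow_minus: "emb (xpow_minus k c) = xpow_minus k (embed c)" for k and c :: 'a
    by (simp add: emb_diff emb_const map_poly_monom embed_hom)
  have Pq: "P ^ q = xpow_minus n \<alpha>1"
    using xpow_minus_frobenius[OF assms(1,5,6) _ assms(8), of 3] assms(7)
    by (simp add: P_def q_def n_def)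
  have l: "l \<le> 2 * q" using assms(15) by (simp add: q_def)
  hence PP: "P ^ l * P ^ (2 * q - l) = (P ^ q) ^ 2"
    by (simp flip: power_add power_mult add: mult.commute)
  have "P \<noteq> 0"
  proof
    assume "P = 0"
    hence "Polynomial.coeff P 3 = 0" by simp
    thus False by (simp add: P_def coeff_pCons)
  qed
  hence N0: "P ^ q \<noteq> 0" by simp
  have M: "xpow_minus n \<alpha> = emb (P ^ q) - [:embed \<alpha>2 * uu + embed \<alpha>3 * vv + embed \<alpha>4 * uu * vv:]"
    unfolding Pq emb_xpow_minus by (simp add: assms(12) add.assoc)
  have ab: "\<alpha> * \<beta> = 1" unfolding assms(14) by (rule uv_inverse[OF assms(9,12)])
  have "\<alpha>0 \<noteq> 0" using assms(8,9) by simp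
  hence e: "embed \<alpha>0 * embed (inverse \<alpha>0) = (1 :: 'a uv_ring)" by (simp flip: embed_hom)
  let ?P = "xpow_minus 3 (embed \<alpha>0)" and ?Q = "xpow_minus 3 (embed (inverse \<alpha>0))"
  let ?J = "gen_ideal (?Q ^ (2 * q - l)) [:uu:] (xpow_minus n \<beta>)"
  have C: "residue_class n \<alpha> f \<in> C \<longleftrightarrow> (\<exists>h. xpow_minus n \<alpha> dvd f - h * ([:uu:] * ?P ^ l))" for f
    unfolding assms(16) n_def q_def by (rule residue_class_in_principal_code_iff)
  \<comment> \<open>Modulo \<open>x ^ n - \<beta>\<close>, membership in the claimed dual is membership of \<open>d(1 / x)\<close> in the annihilator.\<close>
  have key: "d \<in> dual_code n (codewords n \<alpha> C) \<longleftrightarrow> vec_poly d \<in> ?J" if d: "d \<in> carrier_vec n" for d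
  proof -
    let ?f = "subst_recip n \<beta> (vec_poly d)"
    have "d \<in> dual_code n (codewords n \<alpha> C) \<longleftrightarrow> xpow_minus n \<alpha> dvd [:uu:] * ?P ^ l * ?f"
      by (rule dual_code_iff_annihilates[OF ab n d C])
    also have "[:uu:] * ?P ^ l * ?f = emb (P ^ l) * [:uu:] * ?f"
      by (simp only: emb_power P_def emb_xpow_minus mult.commute)
    also have "xpow_minus n \<alpha> dvd emb (P ^ l) * [:uu:] * ?f
      \<longleftrightarrow> (\<exists>x y z. ?f = x * emb (P ^ (2 * q - l)) + y * [:uu:] + z * xpow_minus n \<alpha>)"
      unfolding M by (rule uv_annihilator[OF PP N0 assms(11)])
    also have "\<dots> \<longleftrightarrow> ?f \<in> gen_ideal (?P ^ (2 * q - l)) [:uu:] (xpow_minus n \<alpha>)"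
      unfolding gen_ideal_def emb_power P_def emb_xpow_minus by blast
    also have "\<dots> \<longleftrightarrow> vec_poly d \<in> ?J" by (rule subst_recip_gen_ideal_iff[OF ab n e])
    finally show ?thesis .
  qed
  have dual: "dual_code n (codewords n \<alpha> C) \<subseteq> carrier_vec n" by (auto simp: dual_code_def)
  have code: "code_generated n \<beta> {?Q ^ (2 * q - l), [:uu:]} = residue_class n \<beta> ` ?J"
    by (rule code_generated_eq)
  have "vec_class n \<beta> ` dual_code n (codewords n \<alpha> C) = residue_class n \<beta> ` ?J"
  proof (intro equalityI subsetI)
    fix c assume "c \<in> vec_class n \<beta> ` dual_code n (codewords n \<alpha> C)"
    thus "c \<in> residue_class n \<beta> ` ?J" using key dual by (auto simp: vec_class_def)
  next
    fix c assume "c \<in> residue_class n \<beta> ` ?J"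
    then obtain f where f: "f \<in> ?J" "c = residue_class n \<beta> f" by blast
    obtain d where d: "d \<in> carrier_vec n" "xpow_minus n \<beta> dvd f - vec_poly d"
      using vec_class_representative[OF n] .
    have "d \<in> dual_code n (codewords n \<alpha> C)"
      using key[OF d(1)] f(1) gen_ideal_cong[OF d(2)] by blast
    moreover have "c = vec_class n \<beta> d"
      using f(2) d(2) by (simp add: vec_class_def residue_class_eq_iff)
    ultimately show "c \<in> vec_class n \<beta> ` dual_code n (codewords n \<alpha> C)" by blast
  qed
  thus ?thesis using code by (simp only: n_def q_def)
qed

end
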